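(* Let $P$ be a hereditary semiorder. Then the intervals in the minimal endpoint representation of $P$ can be uniquely described by a block structure; that is, there is exactly one block structure $S$ such that the set of intervals occurring in the minimal endpoint representation of $P$ equals the interval set of $S$.
   Context: All posets are finite and nonempty. A poset $P=(X,\le_P)$ is an interval order if each $x\in X$ can be assigned a closed bounded real interval $I(x)=[\ell(x),r(x)]$ so that $x<_P y$ iff $r(x)<\ell(y)$; it is a semiorder if this can be done with all intervals of the same length. Degenerate intervals $[i,i]$ are allowed, and distinct elements may get the same interval. Minimal endpoint representation: write $D(x)=\{y: y<_P x\}$, $U(x)=\{y: y>_P x\}$. In an interval order the distinct down sets form a chain $D_0\subsetneq\cdots\subsetneq D_{t-1}$ and the distinct up sets form a chain $U_0\supsetneq\cdots\supsetneq U_{t-1}$ (the same number $t$, a known fact). The minimal endpoint representation assigns to $x$ the interval $[i,j]$ where $D(x)=D_i$ and $U(x)=U_j$. Ascent sequences and $\Psi$: for an integer sequence, $\mathrm{asc}(x_1,\dots,x_i)=|\{1\le j<i: x_j<x_{j+1}\}|$. An ascent sequence is a sequence $(x_1,\dots,x_n)$ of nonnegative integers with $x_1=0$ and $x_i\in[0,1+\mathrm{asc}(x_1,\dots,x_{i-1})]$ for $2\le i\le n$. $\Psi$ is the bijection of Bousquet-Mélou et al. from unlabeled interval orders on $n$ points to ascent sequences of length $n$. Its inverse is given recursively (in terms of minimal endpoint representations, as multisets of intervals): $\Psi^{-1}((0))$ has representation $\{[0,0]\}$. Given $Q=\Psi^{-1}((x_1,\dots,x_{n-1}))$, let $\ell(Q)$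 be the largest right endpoint in its minimal endpoint representation (it is known that $\ell(Q)=\mathrm{asc}(x_1,\dots,x_{n-1})$) and $\ell^*(Q)$ the smallest left endpoint of an interval with right endpoint $\ell(Q)$. With $i=x_n$, the minimal endpoint representation of $\Psi^{-1}((x_1,\dots,x_n))$ is obtained by: (Move 1) if $i\le \ell^*(Q)$, add the interval $[i,\ell(Q)]$; (Move 2) if $i=\ell(Q)+1$, add $[\ell(Q)+1,\ell(Q)+1]$; (Move 3) if $\ell^*(Q)<i\le \ell(Q)$, simultaneously replace every $[\lambda,\rho]$ with $\lambda<i\le\rho<\ell(Q)$ by $[\lambda,\rho+1]$, every $[\lambda,\rho]$ with $i\le\lambda\le\rho\le \ell(Q)$ by $[\lambda+1,\rho+1]$, and every $[\lambda,\rho]$ with $\lambda<i$, $\rho=\ell(Q)$ by $[\lambda,i]$, and then add $[i,\ell(Q)+1]$. A semiorder $P$ on $n$ points with $\Psi(P)=(x_1,\dots,x_n)$ is hereditary if $\Psi^{-1}((x_1,\dots,x_i))$ is a semiorder for every $1\le i\le n$. Blocks ($b\ge 0$ an integer): $T_0=\{[0,0]\}$ (the trivial block); $T_1^b=\{[b,b],[b+1,b+1]\}$; $W_k^b=\{[b,b],[b+k,b+k]\}\cup\bigcup_{i=0}^{k-1}\{[b+i,b+i+1]\}$ for $k\ge1$; $C_2^b=\{[b,b],[b,b+1],[b,b+2],[b+1,b+2],[b+2,b+2]\}$; $U_k^b=\bigcup_{i=0}^{k-1}\{[b,b+i],[b+k-i,b+k]\}$ for $k\ge3$; $C_k^b=\{[b,b+k]\}\cup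 U_k^b$ for $k\ge 3$. Blocks are said to be of type $T_1$, $W$, $U$ or $C$ (the latter including $C_2$). Block structure: either the single block $T_0$, or a sequence of $r\ge1$ nontrivial blocks $A_1,\dots,A_r$ with subscripts $k_1,\dots,k_r$ and superscripts $b_1=0$, $b_{j+1}=b_j+k_j$, together with a choice, for each $1\le j<r$, of a boundary between $A_j$ and $A_{j+1}$, which is strong, weak, or weak with optional element (optional interval), subject to: a weak boundary is not allowed if $A_j$ or $A_{j+1}$ is of type $T_1$, nor if both are of type $W$; a weak boundary with optional element is allowed only if $A_j$ is of type $C$ or $U$ and $A_{j+1}$ is of type $W$ or is a $C_2$. The interval set of the block structure is the union of all the blocks, with $[b_{j+1},b_{j+1}]$ removed for each $j$ whose boundary is weak or weak with optional element, and with the optional interval $[b_{j+1}-1,b_{j+1}+1]$ added for each $j$ whose boundary is weak with optional element. (Multiplicities of intervals, i.e. several elements with the same interval, are disregarded.) *)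

theory Defs
  imports Complex_Main "HOL-Library.Multiset"
begin

text \<open>A poset is a carrier \<open>X\<close> with a reflexive order \<open>r\<close> on it, as in
  \<^const>\<open>partial_order_on\<close>; \<open>less_in r\<close> is the associated strict order.\<close>

definition finite_poset :: "'a set \<Rightarrow> ('a \<times> 'a) set \<Rightarrow> bool" where
  "finite_poset X r \<longleftrightarrow> finite X \<and> X \<noteq> {} \<and> partial_order_on X r"

definition less_in :: "('a \<times> 'a) set \<Rightarrow> 'a \<Rightarrow> 'a \<Rightarrow> bool" where
  "less_in r x y \<longleftrightarrow> (x, y) \<in> r \<and> x \<noteq> y"

definition interval_assignment ::
    "'a set \<Rightarrow> ('a \<times> 'a) set \<Rightarrow> ('a \<Rightarrow> real) \<Rightarrow> ('a \<Rightarrow> real) \<Rightarrow> bool" where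
  "interval_assignment X r lft rgt \<longleftrightarrow>
     (\<forall>x\<in>X. lft x \<le> rgt x) \<and>
     (\<forall>x\<in>X. \<forall>y\<in>X. less_in r x y \<longleftrightarrow> rgt x < lft y)"

definition interval_order :: "'a set \<Rightarrow> ('a \<times> 'a) set \<Rightarrow> bool" where
  "interval_order X r \<longleftrightarrow>
     finite_poset X r \<and> (\<exists>lft rgt. interval_assignment X r lft rgt)"

definition semiorder :: "'a set \<Rightarrow> ('a \<times> 'a) set \<Rightarrow> bool" where
  "semiorder X r \<longleftrightarrow>
     finite_poset X r \<and>
     (\<exists>lft rgt c. interval_assignment X r lft rgt \<and> (\<forall>x\<in>X. rgt x - lft x = c))"

subsection \<open>Minimal endpoint representation\<close>

definition down_set :: "'a set \<Rightarrow> ('a \<times> 'a) set \<Rightarrow> 'a \<Rightarrow> 'a set" where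
  "down_set X r x = {y \<in> X. less_in r y x}"

definition up_set :: "'a set \<Rightarrow> ('a \<times> 'a) set \<Rightarrow> 'a \<Rightarrow> 'a set" where
  "up_set X r x = {y \<in> X. less_in r x y}"

text \<open>In an interval order the distinct down sets form a chain
  \<open>D\<^sub>0 \<subset> D\<^sub>1 \<subset> \<dots>\<close> and the distinct up sets a chain \<open>U\<^sub>0 \<supset> U\<^sub>1 \<supset> \<dots>\<close>. The index of
  \<open>down_set X r x\<close> in the first chain is the number of distinct down sets
  preceding it, i.e. properly contained in it; dually for up sets.\<close>

definition left_index :: "'a set \<Rightarrow> ('a \<times> 'a) set \<Rightarrow> 'a \<Rightarrow> nat" where
  "left_index X r x = card {D \<in> down_set X r ` X. D \<subset> down_set X r x}"

definition right_index :: "'a set \<Rightarrow> ('a \<times> 'a) set \<Rightarrow> 'a \<Rightarrow> nat" where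
  "right_index X r x = card {U \<in> up_set X r ` X. up_set X r x \<subset> U}"

definition min_endpoint_rep :: "'a set \<Rightarrow> ('a \<times> 'a) set \<Rightarrow> (nat \<times> nat) multiset" where
  "min_endpoint_rep X r = image_mset (\<lambda>x. (left_index X r x, right_index X r x)) (mset_set X)"

text \<open>The poset represented by a multiset of intervals: the copies \<open>k < count M I\<close>
  of an interval \<open>I\<close> are distinct, pairwise incomparable elements \<open>(I, k)\<close>.\<close>

definition rep_carrier :: "(nat \<times> nat) multiset \<Rightarrow> ((nat \<times> nat) \<times> nat) set" where
  "rep_carrier M = {(I, k). k < count M I}"

definition rep_order ::
    "(nat \<times> nat) multiset \<Rightarrow> (((nat \<times> nat) \<times> nat) \<times> ((nat \<times> nat) \<times> nat)) set" where
  "rep_order M = {(x, y). x \<in> rep_carrier M \<and> y \<in> rep_carrier M \<and>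
                          (x = y \<or> snd (fst x) < fst (fst y))}"

subsection \<open>Ascent sequences and the bijection \<open>\<Psi>\<close>\<close>

definition asc :: "nat list \<Rightarrow> nat" where
  "asc xs = card {j. Suc j < length xs \<and> xs ! j < xs ! Suc j}"

definition ascent_sequence :: "nat list \<Rightarrow> bool" where
  "ascent_sequence xs \<longleftrightarrow>
     xs \<noteq> [] \<and> xs ! 0 = 0 \<and>
     (\<forall>i. 1 \<le> i \<and> i < length xs \<longrightarrow> xs ! i \<le> 1 + asc (take i xs))"

definition ell :: "(nat \<times> nat) multiset \<Rightarrow> nat" where
  "ell M = Max (snd ` set_mset M)"

definition ell_star :: "(nat \<times> nat) multiset \<Rightarrow> nat" where
  "ell_star M = Min (fst ` {I \<in> set_mset M. snd I = ell M})"

definition move3_interval :: "nat \<Rightarrow> nat \<Rightarrow> nat \<times> nat \<Rightarrow> nat \<times> nat" where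
  "move3_interval l i = (\<lambda>(a, b).
     if a < i \<and> i \<le> b \<and> b < l then (a, b + 1)
     else if i \<le> a \<and> a \<le> b \<and> b \<le> l then (a + 1, b + 1)
     else if a < i \<and> b = l then (a, i)
     else (a, b))"

text \<open>The last branch is the move for \<open>i = ell M + 1\<close>, the only remaining
  possibility along an ascent sequence.\<close>

definition psi_step :: "(nat \<times> nat) multiset \<Rightarrow> nat \<Rightarrow> (nat \<times> nat) multiset" where
  "psi_step M i =
     (if i \<le> ell_star M then add_mset (i, ell M) M
      else if i \<le> ell M then
        add_mset (i, ell M + 1) (image_mset (move3_interval (ell M) i) M)
      else add_mset (ell M + 1, ell M + 1) M)"

text \<open>\<open>psi_inv xs\<close> is the minimal endpoint representation of \<open>\<Psi>\<^sup>-\<^sup>1(xs)\<close>, for an ascent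
  sequence \<open>xs\<close>; the recursion is on the last entry, starting from \<open>\<Psi>\<^sup>-\<^sup>1((0))\<close>.\<close>

definition psi_inv :: "nat list \<Rightarrow> (nat \<times> nat) multiset" where
  "psi_inv xs = foldl psi_step {#(0, 0)#} (tl xs)"

text \<open>The graph of \<open>\<Psi>\<close>. An unlabeled interval order is identified with its minimal
  endpoint representation, which determines it up to isomorphism.\<close>

definition Psi :: "'a set \<Rightarrow> ('a \<times> 'a) set \<Rightarrow> nat list \<Rightarrow> bool" where
  "Psi X r xs \<longleftrightarrow>
     interval_order X r \<and> ascent_sequence xs \<and> min_endpoint_rep X r = psi_inv xs"

definition hereditary_semiorder :: "'a set \<Rightarrow> ('a \<times> 'a) set \<Rightarrow> bool" where
  "hereditary_semiorder X r \<longleftrightarrow>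
     semiorder X r \<and>
     (\<exists>xs. Psi X r xs \<and>
       (\<forall>i. 1 \<le> i \<and> i \<le> length xs \<longrightarrow>
          semiorder (rep_carrier (psi_inv (take i xs))) (rep_order (psi_inv (take i xs)))))"

subsection \<open>Block structures\<close>

text \<open>The superscripts are not stored in the blocks: they are forced to be the
  partial sums of the subscripts, see \<open>offset\<close> below.\<close>

datatype block = Block_T0 | Block_T1 | Block_W nat | Block_U nat | Block_C nat

datatype boundary = Strong | Weak | Weak_Optional

type_synonym block_structure = "block list \<times> boundary list"

fun subscript :: "block \<Rightarrow> nat" where
  "subscript Block_T0 = 0"
| "subscript Block_T1 = 1"
| "subscript (Block_W k) = k"
| "subscript (Block_U k) = k"
| "subscript (Block_C k) = k"

definition U_intervals :: "nat \<Rightarrow> nat \<Rightarrow> (nat \<times> nat) set" where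
  "U_intervals b k = (\<Union>i\<in>{0..<k}. {(b, b + i), (b + k - i, b + k)})"

fun block_intervals :: "nat \<Rightarrow> block \<Rightarrow> (nat \<times> nat) set" where
  "block_intervals b Block_T0 = {(0, 0)}"
| "block_intervals b Block_T1 = {(b, b), (b + 1, b + 1)}"
| "block_intervals b (Block_W k) =
     {(b, b), (b + k, b + k)} \<union> (\<Union>i\<in>{0..<k}. {(b + i, b + i + 1)})"
| "block_intervals b (Block_U k) = U_intervals b k"
| "block_intervals b (Block_C k) =
     (if k = 2 then {(b, b), (b, b + 1), (b, b + 2), (b + 1, b + 2), (b + 2, b + 2)}
      else {(b, b + k)} \<union> U_intervals b k)"

fun nontrivial_block :: "block \<Rightarrow> bool" where
  "nontrivial_block Block_T0 \<longleftrightarrow> False"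
| "nontrivial_block Block_T1 \<longleftrightarrow> True"
| "nontrivial_block (Block_W k) \<longleftrightarrow> k \<ge> 1"
| "nontrivial_block (Block_U k) \<longleftrightarrow> k \<ge> 3"
| "nontrivial_block (Block_C k) \<longleftrightarrow> k \<ge> 2"

definition is_T1 :: "block \<Rightarrow> bool" where
  "is_T1 A \<longleftrightarrow> A = Block_T1"

definition is_W :: "block \<Rightarrow> bool" where
  "is_W A \<longleftrightarrow> (\<exists>k. A = Block_W k)"

definition is_U :: "block \<Rightarrow> bool" where
  "is_U A \<longleftrightarrow> (\<exists>k. A = Block_U k)"

definition is_C :: "block \<Rightarrow> bool" where
  "is_C A \<longleftrightarrow> (\<exists>k. A = Block_C k)"

fun boundary_allowed :: "block \<Rightarrow> boundary \<Rightarrow> block \<Rightarrow> bool" where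
  "boundary_allowed A Strong B \<longleftrightarrow> True"
| "boundary_allowed A Weak B \<longleftrightarrow> \<not> is_T1 A \<and> \<not> is_T1 B \<and> \<not> (is_W A \<and> is_W B)"
| "boundary_allowed A Weak_Optional B \<longleftrightarrow>
     (is_C A \<or> is_U A) \<and> (is_W B \<or> B = Block_C 2)"

text \<open>With 0-based positions, \<open>bs ! j\<close> is the boundary between \<open>As ! j\<close> and \<open>As ! Suc j\<close>.\<close>

definition is_block_structure :: "block_structure \<Rightarrow> bool" where
  "is_block_structure = (\<lambda>(As, bs).
     As = [Block_T0] \<and> bs = [] \<or>
     As \<noteq> [] \<and> (\<forall>A\<in>set As. nontrivial_block A) \<and>
     length bs + 1 = length As \<and>
     (\<forall>j<length bs. boundary_allowed (As ! j) (bs ! j) (As ! Suc j)))"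

definition offset :: "block list \<Rightarrow> nat \<Rightarrow> nat" where
  "offset As j = sum_list (map subscript (take j As))"

definition interval_set :: "block_structure \<Rightarrow> (nat \<times> nat) set" where
  "interval_set = (\<lambda>(As, bs).
     ((\<Union>j\<in>{0..<length As}. block_intervals (offset As j) (As ! j))
       - {(offset As (Suc j), offset As (Suc j)) | j.
            j < length bs \<and> (bs ! j = Weak \<or> bs ! j = Weak_Optional)})
     \<union> {(offset As (Suc j) - 1, offset As (Suc j) + 1) | j.
            j < length bs \<and> bs ! j = Weak_Optional})"

end

theory Submission
  imports Defs
begin

text \<open>
  The argument rests on rewriting interval sets of block structures as unions from which nothing is
  removed. A block structure becomes a list of blocks, each paired with the boundary on its left
  (strong for the first one); the trivial structure becomes the empty list. At its starting point
  \<open>b\<close>, a pair contributes its \<open>joint\<close>, namely \<open>[b, b]\<close>, nothing, or the optional interval, and the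
  nondegenerate intervals of its block (\<open>inner\<close>). Adding the degenerate interval at the very end gives
  the interval set (\<open>interval_set_structure_of\<close>). Appending or exchanging a last block is now
  transparent.

  Existence. In a minimal endpoint representation every number \<open>0, \<dots>, l\<close> is both a left and a right
  endpoint. So if \<open>a < b \<le> c < d\<close> and both \<open>[a, d]\<close> and \<open>[b, c]\<close> occur, then \<open>[b, c]\<close> lies between an
  interval ending at \<open>a\<close> and one starting at \<open>d\<close>, while \<open>[a, d]\<close> meets all three; a semiorder forbids
  this (\<open>semiorder_no_nesting\<close>). Starting from the trivial structure, each move either creates such a
  strict nesting or changes only the end of the list of blocks. Up to moves without effect, the
  possible changes are as follows.

  \<^item> Move 1 turns \<open>T\<^sub>1\<close> into \<open>W\<^sub>1\<close>, \<open>W\<^sub>2\<close> into \<open>C\<^sub>2\<close>, \<open>W\<^sub>k\<close> with \<open>k \<ge> 3\<close> into \<open>W\<^bsub>k-2\<^esub>\<close> followed weakly by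
    \<open>C\<^sub>2\<close>, \<open>U\<^sub>k\<close> into \<open>C\<^sub>k\<close>, or adds the optional element to a weak boundary before \<open>W\<^sub>1\<close>.
  \<^item> Move 2 appends \<open>T\<^sub>1\<close> with a strong boundary.
  \<^item> Move 3 turns \<open>W\<^sub>k\<close> into \<open>W\<^bsub>k+1\<^esub>\<close>, \<open>C\<^sub>k\<close> into \<open>U\<^bsub>k+1\<^esub>\<close>, or appends \<open>W\<^sub>1\<close> weakly to a \<open>U\<close> or \<open>C\<close>.

  This is \<open>add_interval\<close>, \<open>shift_intervals\<close> and \<open>psi_step_valid_seq\<close>.

  Uniqueness. The blocks can be read off the set of intervals from left to right: the intervals that
  start at or after the left end of a block determine its type and length (\<open>decode_block_correct\<close>), and
  the intervals at its left end reveal the boundary. The direction matters: a run of copies of \<open>C\<^sub>2\<close>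
  joined by weak boundaries with optional elements looks the same near its right end whether its last
  block is \<open>C\<^sub>2\<close> or \<open>W\<^sub>1\<close>, and only its left end decides.
\<close>

section \<open>Block structures as sequences of disjoint pieces\<close>

type_synonym block_seq = "(boundary \<times> block) list"

definition extent :: "block_seq \<Rightarrow> nat" where
  "extent L = sum_list (map (subscript \<circ> snd) L)"

fun joint :: "nat \<Rightarrow> boundary \<Rightarrow> (nat \<times> nat) set" where
  "joint b Strong = {(b, b)}"
| "joint b Weak = {}"
| "joint b Weak_Optional = {(b - 1, b + 1)}"

text \<open>The nondegenerate intervals of a block. Written without unions, the description of \<open>C\<^sub>k\<close> covers
  \<open>k = 2\<close> as well as \<open>k \<ge> 3\<close>.\<close>

fun inner :: "nat \<Rightarrow> block \<Rightarrow> (nat \<times> nat) set" where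
  "inner b Block_T0 = {}"
| "inner b Block_T1 = {}"
| "inner b (Block_W k) = {(x, y). b \<le> x \<and> x < b + k \<and> y = x + 1}"
| "inner b (Block_U k) = {(x, y). x < y \<and> (x = b \<and> y < b + k \<or> b < x \<and> y = b + k)}"
| "inner b (Block_C k) = {(x, y). x < y \<and> (x = b \<and> y \<le> b + k \<or> b < x \<and> y = b + k)}"

fun placed :: "nat \<Rightarrow> block_seq \<Rightarrow> (nat \<times> nat) set" where
  "placed b [] = {}"
| "placed b ((c, A) # L) = joint b c \<union> inner b A \<union> placed (b + subscript A) L"

definition seq_intervals :: "nat \<Rightarrow> block_seq \<Rightarrow> (nat \<times> nat) set" where
  "seq_intervals b L = insert (b + extent L, b + extent L) (placed b L)"

definition compatible :: "boundary \<times> block \<Rightarrow> boundary \<times> block \<Rightarrow> bool" where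
  "compatible p q \<longleftrightarrow> boundary_allowed (snd p) (fst q) (snd q)"

text \<open>The conditions on a block structure that pass to final segments. The condition on the first
  boundary is separate (\<open>valid_seq\<close>), since uniqueness is proved by removing blocks from the front.\<close>

definition linked :: "block_seq \<Rightarrow> bool" where
  "linked L \<longleftrightarrow> (\<forall>p\<in>set L. nontrivial_block (snd p)) \<and> successively compatible L"

definition valid_seq :: "block_seq \<Rightarrow> bool" where
  "valid_seq L \<longleftrightarrow> linked L \<and> (L \<noteq> [] \<longrightarrow> fst (hd L) = Strong)"

lemma extent_simps [simp]:
  "extent [] = 0" "extent (p # L) = subscript (snd p) + extent L" "extent (K @ L) = extent K + extent L"
  by (simp_all add: extent_def)

lemma placed_append: "placed b (K @ L) = placed b K \<union> placed (b + extent K) L"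
  by (induction b K rule: placed.induct) (auto simp: add.assoc)

lemma subscript_pos: "nontrivial_block A \<Longrightarrow> 0 < subscript A"
  by (cases A) auto

lemma block_intervals_inner:
  assumes "nontrivial_block A"
  shows "block_intervals b A = inner b A \<union> {(b, b), (b + subscript A, b + subscript A)}"
proof -
  have U: "U_intervals b k = {(x, y). x < y \<and> (x = b \<and> y < b + k \<or> b < x \<and> y = b + k)}
             \<union> {(b, b), (b + k, b + k)}" if "k \<ge> 1" for k
  proof (intro equalityI subrelI)
    fix x y assume "(x, y) \<in> U_intervals b k"
    then show "(x, y) \<in> {(x, y). x < y \<and> (x = b \<and> y < b + k \<or> b < x \<and> y = b + k)}
             \<union> {(b, b), (b + k, b + k)}"
      by (auto simp: U_intervals_def)
  next
    fix x y assume h: "(x, y) \<in> {(x, y). x < y \<and> (x = b \<and> y < b + k \<or> b < x \<and> y = b + k)}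
             \<union> {(b, b), (b + k, b + k)}"
    have "\<exists>i\<in>{0..<k}. (x, y) = (b, b + i) \<or> (x, y) = (b + k - i, b + k)"
    proof (cases "x = b \<and> y < b + k")
      case True
      then show ?thesis using h by (intro bexI[of _ "y - b"]) auto
    next
      case False
      then show ?thesis using h that by (intro bexI[of _ "b + k - x"]) auto
    qed
    then show "(x, y) \<in> U_intervals b k" by (auto simp: U_intervals_def)
  qed
  show ?thesis
  proof (cases A)
    case (Block_W k)
    have "(\<Union>i\<in>{0..<k}. {(b + i, b + i + 1)}) = inner b A"
    proof (intro equalityI subrelI)
      fix x y assume "(x, y) \<in> inner b A"
      then show "(x, y) \<in> (\<Union>i\<in>{0..<k}. {(b + i, b + i + 1)})"
        using Block_W by (intro UN_I[of "x - b"]) auto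
    qed (use Block_W in auto)
    then have "block_intervals b A = {(b, b), (b + k, b + k)} \<union> inner b A"
      using Block_W by (simp del: inner.simps)
    then show ?thesis using Block_W by (simp add: Un_commute del: inner.simps block_intervals.simps)
  next
    case (Block_U k)
    then show ?thesis using U[of k] assms by simp
  next
    case (Block_C k)
    show ?thesis
    proof (cases "k = 2")
      case True
      have "inner b (Block_C 2) = {(b, b + 1), (b, b + 2), (b + 1, b + 2)}" by auto
      then show ?thesis using Block_C True by (simp add: insert_commute del: inner.simps)
    next
      case False
      have "inner b A = insert (b, b + k)
              {(x, y). x < y \<and> (x = b \<and> y < b + k \<or> b < x \<and> y = b + k)}"
        using Block_C assms by auto
      then show ?thesis using Block_C False U[of k] assms
        by (simp add: insert_commute del: inner.simps)
    qed
  qed (use assms in auto)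
qed

lemma inner_bounds:
  "(x, y) \<in> inner b A \<Longrightarrow> b \<le> x \<and> x < y \<and> y \<le> b + subscript A"
  by (cases A) auto

text \<open>Only an optional interval at the front can stick out to the left of \<open>b\<close>, and it still ends to the
  right of \<open>b\<close>; this keeps the contributions of different blocks apart.\<close>

lemma placed_bounds:
  assumes "\<forall>p\<in>set L. nontrivial_block (snd p)" "(x, y) \<in> placed b L"
  shows "b \<le> x + 1 \<and> x \<le> y \<and> x < b + extent L \<and> y \<le> b + extent L
           \<and> (b < y \<or> x = b \<and> y = b \<and> fst (hd L) = Strong)"
  using assms
proof (induction b L rule: placed.induct)
  case (2 b c A L)
  have pos: "0 < subscript A" using "2.prems"(1) by (auto intro: subscript_pos)
  from "2.prems"(2) consider "(x, y) \<in> joint b c" | "(x, y) \<in> inner b A"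
    | "(x, y) \<in> placed (b + subscript A) L" by auto
  then show ?case
  proof cases
    case 1
    then show ?thesis using pos by (cases c) auto
  next
    case 2
    then show ?thesis using inner_bounds[OF 2] by auto
  next
    case 3
    from "2.IH"[OF _ 3] "2.prems"(1) pos show ?thesis by auto
  qed
qed simp

subsection \<open>Agreement with the interval set of a block structure\<close>

definition structure_of :: "block_seq \<Rightarrow> block_structure" where
  "structure_of L = (if L = [] then ([Block_T0], []) else (map snd L, tl (map fst L)))"

lemma placed_nth:
  "placed b L = (\<Union>j<length L. joint (b + extent (take j L)) (fst (L ! j))
                              \<union> inner (b + extent (take j L)) (snd (L ! j)))"
proof (induction b L rule: placed.induct)
  case (2 b c A L)
  show ?case
    unfolding placed.simps "2.IH" list.size
    by (simp add: lessThan_Suc_eq_insert_0 image_image add.assoc)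
qed simp

lemma extent_take_strict_mono:
  assumes "\<forall>p\<in>set L. nontrivial_block (snd p)" "i < j" "j \<le> length L"
  shows "extent (take i L) < extent (take j L)"
  using assms(2,3)
proof (induction j)
  case (Suc j)
  have "extent (take (Suc j) L) = extent (take j L) + subscript (snd (L ! j))"
    using Suc.prems by (simp add: take_Suc_conv_app_nth)
  moreover have "0 < subscript (snd (L ! j))"
    using Suc.prems assms(1) by (intro subscript_pos) simp
  moreover have "extent (take i L) \<le> extent (take j L)"
    using Suc by (cases "i = j") auto
  ultimately show ?case by linarith
qed simp

text \<open>The list is recovered by pairing the blocks with the boundaries, preceded by a strong one.\<close>

lemma is_block_structure_iff:
  "is_block_structure S \<longleftrightarrow> (\<exists>L. valid_seq L \<and> S = structure_of L)"
proof
  assume S: "is_block_structure S"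
  obtain As bs where [simp]: "S = (As, bs)" by (cases S)
  show "\<exists>L. valid_seq L \<and> S = structure_of L"
  proof (cases "As = [Block_T0] \<and> bs = []")
    case True
    then show ?thesis
      by (intro exI[of _ "[]"]) (simp add: structure_of_def valid_seq_def linked_def)
  next
    case False
    then have ne: "As \<noteq> []" and nt: "\<forall>A\<in>set As. nontrivial_block A"
      and len: "length (Strong # bs) = length As"
      and al: "\<forall>j<length bs. boundary_allowed (As ! j) (bs ! j) (As ! Suc j)"
      using S by (auto simp: is_block_structure_def)
    let ?L = "zip (Strong # bs) As"
    have m: "map snd ?L = As" "map fst ?L = Strong # bs"
      using len by simp_all
    have "successively compatible ?L"
      using al len by (auto simp: successively_conv_nth compatible_def)
    moreover have "\<forall>p\<in>set ?L. nontrivial_block (snd p)"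
      using nt by (auto dest: set_zip_rightD)
    moreover have "?L \<noteq> []" using ne by (cases As) auto
    moreover have "fst (hd ?L) = Strong" using ne by (cases As) auto
    ultimately show ?thesis
      using m by (intro exI[of _ ?L]) (simp add: structure_of_def valid_seq_def linked_def)
  qed
next
  assume "\<exists>L. valid_seq L \<and> S = structure_of L"
  then obtain L where L: "valid_seq L" "S = structure_of L" by blast
  show "is_block_structure S"
  proof (cases L)
    case Nil
    then show ?thesis using L by (simp add: structure_of_def is_block_structure_def)
  next
    case (Cons p K)
    have "boundary_allowed (map snd L ! j) (tl (map fst L) ! j) (map snd L ! Suc j)"
      if "j < length K" for j
    proof -
      have "map snd L ! j = snd (L ! j)"
        using that Cons by (intro nth_map) simp
      then show ?thesis
        using L(1) that Cons
        by (auto simp: valid_seq_def linked_def successively_conv_nth compatible_def)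
    qed
    then show ?thesis
      using L Cons
      by (auto simp: structure_of_def is_block_structure_def valid_seq_def linked_def
               simp del: nth_Cons_Suc)
  qed
qed

text \<open>The blocks together contain \<open>[b, b]\<close> for every block end \<open>b\<close>. Distinct positions have distinct
  offsets and inner intervals are nondegenerate, so removing such an interval at a weak boundary
  affects nothing else and leaves exactly what the joints supply.\<close>

lemma interval_set_structure_of:
  assumes "valid_seq L"
  shows "interval_set (structure_of L) = seq_intervals 0 L"
proof (cases "L = []")
  case True
  then show ?thesis
    by (simp add: structure_of_def interval_set_def seq_intervals_def)
next
  case False
  define n o' where "n = length L" and "o' j = extent (take j L)" for j
  define C where "C j = fst (L ! j)" for j
  define I where "I = (\<Union>j<n. inner (o' j) (snd (L ! j)))"
  have nt: "\<forall>p\<in>set L. nontrivial_block (snd p)" and first: "C 0 = Strong" and n: "n > 0"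
    using assms False by (auto simp: valid_seq_def linked_def C_def n_def hd_conv_nth)
  have off: "offset (map snd L) j = o' j" for j
    by (simp add: offset_def o'_def extent_def take_map)
  have inj: "o' i = o' j \<longleftrightarrow> i = j" if "i \<le> n" "j \<le> n" for i j
    using extent_take_strict_mono[OF nt, of i j] extent_take_strict_mono[OF nt, of j i] that
    by (metis less_irrefl linorder_neqE_nat n_def o'_def)
  have suc: "o' (Suc j) = o' j + subscript (snd (L ! j))" if "j < n" for j
    using that by (simp add: o'_def n_def take_Suc_conv_app_nth)
  have last: "o' n = extent L" by (simp add: o'_def n_def)
  have bl: "block_intervals (o' j) (snd (L ! j))
              = inner (o' j) (snd (L ! j)) \<union> {(o' j, o' j), (o' (Suc j), o' (Suc j))}"
    if "j < n" for j
    using block_intervals_inner[of "snd (L ! j)" "o' j"] nt that suc[OF that] by (simp add: n_def)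
  have diag: "(x, x) \<notin> I" for x
    using inner_bounds by (fastforce simp: I_def)
  have blocks: "(\<Union>j\<in>{0..<n}. block_intervals (o' j) (snd (L ! j)))
                  = I \<union> {(o' j, o' j) | j. j \<le> n}"
  proof -
    have "{(o' j, o' j) | j. j \<le> n} = (\<Union>j<n. {(o' j, o' j), (o' (Suc j), o' (Suc j))})"
    proof (intro set_eqI iffI)
      fix q assume "q \<in> {(o' j, o' j) | j. j \<le> n}"
      then obtain j where j: "q = (o' j, o' j)" "j \<le> n" by blast
      show "q \<in> (\<Union>j<n. {(o' j, o' j), (o' (Suc j), o' (Suc j))})"
      proof (cases j)
        case 0 then show ?thesis using j n by auto
      next
        case (Suc i) then show ?thesis using j by auto
      qed
    next
      fix q assume "q \<in> (\<Union>j<n. {(o' j, o' j), (o' (Suc j), o' (Suc j))})"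
      then show "q \<in> {(o' j, o' j) | j. j \<le> n}"
        by (auto intro: less_imp_le)
    qed
    then show ?thesis using bl by (auto simp: I_def)
  qed
  have seq: "seq_intervals 0 L = insert (o' n, o' n) ((\<Union>j<n. joint (o' j) (C j)) \<union> I)"
    unfolding seq_intervals_def placed_nth last[symmetric]
    by (auto simp: I_def o'_def n_def C_def)
  define R where "R = {(o' (Suc j), o' (Suc j)) | j. Suc j < n \<and> C (Suc j) \<noteq> Strong}"
  define Q where "Q = {(o' (Suc j) - 1, o' (Suc j) + 1) | j. Suc j < n \<and> C (Suc j) = Weak_Optional}"
  have bs: "tl (map fst L) ! j = C (Suc j)" if "Suc j < n" for j
    using that by (simp add: C_def n_def nth_tl)
  have weak: "c = Weak \<or> c = Weak_Optional \<longleftrightarrow> c \<noteq> Strong" for c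
    by (cases c) auto
  have "interval_set (structure_of L) = (I \<union> {(o' j, o' j) | j. j \<le> n} - R) \<union> Q"
  proof -
    have "{(o' (Suc j), o' (Suc j)) |j. j < n - 1 \<and> (tl (map fst L) ! j = Weak \<or> tl (map fst L) ! j = Weak_Optional)} = R"
      using bs weak unfolding R_def by (auto simp: less_diff_conv)
    moreover have "{(o' (Suc j) - 1, o' (Suc j) + 1) |j. j < n - 1 \<and> tl (map fst L) ! j = Weak_Optional} = Q"
      using bs unfolding Q_def by (auto simp: less_diff_conv)
    moreover have "(\<Union>j\<in>{0..<n}. block_intervals (o' j) (map snd L ! j))
        = (\<Union>j\<in>{0..<n}. block_intervals (o' j) (snd (L ! j)))"
      by (intro SUP_cong) (auto simp: n_def)
    ultimately show ?thesis
      using False blocks by (simp add: interval_set_def structure_of_def off n_def)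
  qed
  also have "\<dots> = I \<union> ({(o' j, o' j) | j. j \<le> n} - R) \<union> Q"
    using diag by (auto simp: R_def)
  also have "{(o' j, o' j) | j. j \<le> n} - R
               = insert (o' n, o' n) {(o' j, o' j) | j. j < n \<and> C j = Strong}"
  proof (intro set_eqI iffI)
    fix q assume "q \<in> {(o' j, o' j) | j. j \<le> n} - R"
    then obtain j where j: "q = (o' j, o' j)" "j \<le> n" "q \<notin> R" by blast
    have "C j = Strong" if "j < n"
      using that j first by (cases j) (auto simp: R_def)
    then show "q \<in> insert (o' n, o' n) {(o' j, o' j) | j. j < n \<and> C j = Strong}"
      using j le_neq_implies_less by blast
  next
    fix q assume "q \<in> insert (o' n, o' n) {(o' j, o' j) | j. j < n \<and> C j = Strong}"
    then obtain j where j: "q = (o' j, o' j)" "j \<le> n" "j = n \<or> C j = Strong" by auto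
    have "q \<notin> R"
      using j inj by (auto simp: R_def)
    then show "q \<in> {(o' j, o' j) | j. j \<le> n} - R" using j by blast
  qed
  also have "I \<union> insert (o' n, o' n) {(o' j, o' j) | j. j < n \<and> C j = Strong} \<union> Q
               = seq_intervals 0 L"
  proof -
    have "{(o' j, o' j) | j. j < n \<and> C j = Strong} \<union> Q = (\<Union>j<n. joint (o' j) (C j))"
    proof (intro set_eqI iffI)
      fix q assume "q \<in> {(o' j, o' j) | j. j < n \<and> C j = Strong} \<union> Q"
      then consider j where "j < n" "C j = Strong" "q = (o' j, o' j)"
        | j where "Suc j < n" "C (Suc j) = Weak_Optional" "q = (o' (Suc j) - 1, o' (Suc j) + 1)"
        by (auto simp: Q_def)
      then show "q \<in> (\<Union>j<n. joint (o' j) (C j))"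
      proof cases
        case (1 j) then show ?thesis by (intro UN_I[of j]) auto
      next
        case (2 j) then show ?thesis by (intro UN_I[of "Suc j"]) auto
      qed
    next
      fix q assume "q \<in> (\<Union>j<n. joint (o' j) (C j))"
      then obtain j where j: "j < n" "q \<in> joint (o' j) (C j)" by blast
      show "q \<in> {(o' j, o' j) | j. j < n \<and> C j = Strong} \<union> Q"
      proof (cases "C j")
        case Weak_Optional
        with first obtain i where "j = Suc i" by (cases j) auto
        with j Weak_Optional show ?thesis by (auto simp: Q_def)
      qed (use j in auto)
    qed
    then show ?thesis using seq by auto
  qed
  finally show ?thesis .
qed

section \<open>Uniqueness: reading the blocks from left to right\<close>

text \<open>The type of a block starting at \<open>b\<close> is decided by the intervals \<open>[b, b + 1]\<close> and \<open>[b, b + 2]\<close>.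
  A block \<open>W\<^sub>k\<close> is followed by the end of the list, a strong boundary, or a weak boundary and a block
  of type \<open>U\<close> or \<open>C\<close>; its end is therefore the first later point \<open>b + k\<close> that carries \<open>[b + k, b + k]\<close>
  or \<open>[b + k, b + k + 2]\<close>. In \<open>U\<^sub>k\<close> and \<open>C\<^sub>k\<close> the only intervals of length 1 are the first and the last
  one, which gives \<open>k\<close>, and \<open>[b, b + k]\<close> tells the two types apart.\<close>

definition decode_block :: "nat \<Rightarrow> (nat \<times> nat) set \<Rightarrow> block" where
  "decode_block b Z =
     (if (b, b + 1) \<notin> Z then Block_T1
      else if (b, b + 2) \<notin> Z
      then Block_W (LEAST k. 1 \<le> k \<and> ((b + k, b + k) \<in> Z \<or> (b + k, b + k + 2) \<in> Z))
      else (let k = LEAST k. 2 \<le> k \<and> (b + k - 1, b + k) \<in> Z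
            in if (b, b + k) \<in> Z then Block_C k else Block_U k))"

lemma linked_Cons:
  "linked (p # L) \<longleftrightarrow> nontrivial_block (snd p) \<and> linked L \<and> (L \<noteq> [] \<longrightarrow> compatible p (hd L))"
  by (cases L) (auto simp: linked_def)

lemma seq_intervals_Cons:
  "seq_intervals b ((c, A) # L) = joint b c \<union> inner b A \<union> seq_intervals (b + subscript A) L"
  by (auto simp: seq_intervals_def add.assoc)

lemma seq_intervals_bounds:
  assumes "linked L" "(x, y) \<in> seq_intervals b L"
  shows "b \<le> x + 1 \<and> x \<le> y \<and> (b < y \<or> x = b \<and> y = b)"
  using assms placed_bounds[of L x y b] by (auto simp: seq_intervals_def linked_def)

text \<open>Everything to the left of the starting point comes from the first boundary.\<close>

lemma seq_intervals_left:
  assumes "linked L" "(x, y) \<in> seq_intervals b L" "x < b"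
  shows "L \<noteq> [] \<and> fst (hd L) = Weak_Optional \<and> (x, y) = (b - 1, b + 1)"
proof (cases L)
  case (Cons p K)
  obtain c A where [simp]: "p = (c, A)" by (cases p)
  have nt: "nontrivial_block A" and K: "linked K" using assms Cons by (auto simp: linked_Cons)
  from assms Cons consider "(x, y) \<in> joint b c" | "(x, y) \<in> inner b A"
    | "(x, y) \<in> seq_intervals (b + subscript A) K" by (auto simp: seq_intervals_Cons)
  then show ?thesis
  proof cases
    case 1
    then show ?thesis using assms Cons by (cases c) auto
  next
    case 2
    then show ?thesis using inner_bounds[OF 2] assms by auto
  next
    case 3
    \<comment> \<open>An optional interval two blocks on would have to start at \<open>b - 1\<close> or earlier, so the block
      in between would have length at most 0.\<close>
    have "b + subscript A \<le> x + 1"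
      using seq_intervals_bounds[OF K 3] by simp
    then show ?thesis using subscript_pos[OF nt] assms by simp
  qed
qed (use assms in \<open>simp add: seq_intervals_def\<close>)

text \<open>The remaining blocks could only interfere through an optional interval at the right end of \<open>A\<close>.
  This occurs only after \<open>U\<close> and \<open>C\<close>, and the interval then starts inside \<open>A\<close> but ends beyond it.
  At \<open>b = 0\<close> truncated subtraction would turn the optional interval of the joint into \<open>[0, 1]\<close>;
  hence the assumption on \<open>b\<close>.\<close>

lemma decode_block_correct:
  assumes L: "linked ((c, A) # L)" and pos: "c = Weak_Optional \<Longrightarrow> 0 < b"
  shows "decode_block b (seq_intervals b ((c, A) # L)) = A"
proof -
  define k where "k = subscript A"
  let ?Z = "seq_intervals b ((c, A) # L)"
  let ?T = "seq_intervals (b + k) L"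
  have A: "nontrivial_block A" and T: "linked L" using L by (auto simp: linked_Cons)
  have k0: "0 < k" using subscript_pos[OF A] by (simp add: k_def)
  have Z: "?Z = joint b c \<union> inner b A \<union> ?T" by (simp add: seq_intervals_Cons k_def)
  have jn: "(x, y) \<notin> joint b c" if "b \<le> x" "x < y" for x y
    using that pos by (cases c) auto
  have opt: "is_C A \<or> is_U A" if "(x, y) \<in> ?T" "x < b + k" for x y
    using seq_intervals_left[OF T that] L by (auto simp: linked_Cons compatible_def)
  have Tb: "b + k \<le> x + 1 \<and> x \<le> y \<and> (b + k < y \<or> x = b + k \<and> y = b + k)"
    if "(x, y) \<in> ?T" for x y
    using seq_intervals_bounds[OF T that] .
  have CU: ?thesis if AA: "A = Block_C k \<and> 2 \<le> k \<or> A = Block_U k \<and> 3 \<le> k"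
  proof -
    have mem: "(x, y) \<in> ?Z \<longleftrightarrow> (x, y) \<in> inner b A" if "b \<le> x" "x < y" "y \<le> b + k" for x y
      using Z jn[OF that(1,2)] Tb[of x y] that by auto
    have "(b, b + 1) \<in> ?Z" "(b, b + 2) \<in> ?Z"
      using mem[of b "b + 1"] mem[of b "b + 2"] AA by auto
    moreover have "(LEAST k. 2 \<le> k \<and> (b + k - 1, b + k) \<in> ?Z) = k"
    proof (rule Least_equality)
      show "2 \<le> k \<and> (b + k - 1, b + k) \<in> ?Z"
        using mem[of "b + k - 1" "b + k"] AA by auto
    next
      fix j assume j: "2 \<le> j \<and> (b + j - 1, b + j) \<in> ?Z"
      show "k \<le> j"
      proof (rule ccontr)
        assume "\<not> k \<le> j"
        moreover have "b \<le> b + j - 1" using j by linarith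
        ultimately have "(b + j - 1, b + j) \<in> inner b A"
          using mem[of "b + j - 1" "b + j"] j by simp
        then show False using j AA \<open>\<not> k \<le> j\<close> by auto
      qed
    qed
    moreover have "(b, b + k) \<in> ?Z \<longleftrightarrow> A = Block_C k"
      using mem[of b "b + k"] AA by auto
    ultimately show ?thesis using AA by (auto simp: decode_block_def Let_def)
  qed
  show ?thesis
  proof (cases A)
    case Block_T1
    have "(b, b + 1) \<notin> ?T"
      using Tb[of b "b + 1"] opt[of b "b + 1"] Block_T1 by (auto simp: is_C_def is_U_def k_def)
    then have "(b, b + 1) \<notin> ?Z" using Z jn Block_T1 by auto
    then show ?thesis using Block_T1 by (simp add: decode_block_def)
  next
    case (Block_W k')
    then have [simp]: "k' = k" by (simp add: k_def)
    have noT: "(x, y) \<notin> ?T" if "x < b + k" for x y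
      using opt[OF _ that] Block_W by (auto simp: is_C_def is_U_def)
    have "(b, b + 1) \<in> ?Z" "(b, b + 2) \<notin> ?Z"
      using Z jn noT k0 Block_W by auto
    moreover have "(LEAST k. 1 \<le> k \<and> ((b + k, b + k) \<in> ?Z \<or> (b + k, b + k + 2) \<in> ?Z)) = k"
    proof (rule Least_equality)
      have "(b + k, b + k) \<in> ?T \<or> (b + k, b + k + 2) \<in> ?T"
      proof (cases L)
        case Nil
        then show ?thesis by (simp add: seq_intervals_def)
      next
        case (Cons p K)
        obtain c' B where [simp]: "p = (c', B)" by (cases p)
        have "nontrivial_block B" "boundary_allowed A c' B"
          using L Cons by (auto simp: linked_Cons compatible_def)
        then show ?thesis
          using Cons Block_W
          by (cases c'; cases B)
             (auto simp: seq_intervals_Cons is_C_def is_U_def is_W_def is_T1_def)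
      qed
      then show "1 \<le> k \<and> ((b + k, b + k) \<in> ?Z \<or> (b + k, b + k + 2) \<in> ?Z)"
        using k0 Z by auto
    next
      fix j assume j: "1 \<le> j \<and> ((b + j, b + j) \<in> ?Z \<or> (b + j, b + j + 2) \<in> ?Z)"
      show "k \<le> j"
      proof (rule ccontr)
        assume "\<not> k \<le> j"
        moreover have "(b + j, b + j) \<notin> joint b c" using j by (cases c) auto
        ultimately show False using j Z noT jn[of "b + j" "b + j + 2"] Block_W by auto
      qed
    qed
    ultimately show ?thesis using Block_W by (simp add: decode_block_def)
  next
    case (Block_U k')
    then show ?thesis using CU A by (simp add: k_def)
  next
    case (Block_C k')
    then show ?thesis using CU A by (simp add: k_def)
  qed (use A in simp)
qed

text \<open>After the first block and its boundary are identified, the intervals of the remaining list are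
  those that end beyond the first block, together with the degenerate interval at its right end if
  present, so the induction can continue behind the first block.\<close>

lemma seq_intervals_inject:
  assumes "linked L" "linked L'" "seq_intervals b L = seq_intervals b L'"
    and "L \<noteq> [] \<Longrightarrow> fst (hd L) = Weak_Optional \<Longrightarrow> 0 < b"
    and "L' \<noteq> [] \<Longrightarrow> fst (hd L') = Weak_Optional \<Longrightarrow> 0 < b"
  shows "L = L'"
  using assms
proof (induction L arbitrary: b L')
  case Nil
  show ?case
  proof (cases L')
    case (Cons p K)
    then have "0 < extent L'" using Nil.prems subscript_pos by (auto simp: linked_Cons)
    moreover have "(b + extent L', b + extent L') \<in> seq_intervals b L'" by (simp add: seq_intervals_def)
    ultimately show ?thesis using Nil.prems(3) by (simp add: seq_intervals_def)
  qed simp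
next
  case (Cons p K)
  obtain c A where p [simp]: "p = (c, A)" by (cases p)
  have "L' \<noteq> []"
  proof
    assume "L' = []"
    moreover have "0 < extent (p # K)" using Cons.prems subscript_pos by (auto simp: linked_Cons)
    moreover have "(b + extent (p # K), b + extent (p # K)) \<in> seq_intervals b (p # K)"
      by (simp add: seq_intervals_def)
    ultimately show False using Cons.prems(3) by (simp add: seq_intervals_def)
  qed
  then obtain c' A' K' where L' [simp]: "L' = (c', A') # K'" by (cases L') auto
  let ?Z = "seq_intervals b ((c, A) # K)"
  have Z': "?Z = seq_intervals b ((c', A') # K')" using Cons.prems(3) by simp
  have "decode_block b ?Z = A" "decode_block b ?Z = A'"
    using decode_block_correct[of c A K b] Cons.prems(1,4) apply simp
    using decode_block_correct[of c' A' K' b] Cons.prems(2,5) Z' by simp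
  then have A' [simp]: "A' = A" by simp
  have k: "0 < subscript A" using Cons.prems(1) subscript_pos by (auto simp: linked_Cons)
  have diag: "(b, b) \<in> seq_intervals b ((d, A) # M) \<longleftrightarrow> d = Strong"
    and opt: "0 < b \<Longrightarrow> (b - 1, b + 1) \<in> seq_intervals b ((d, A) # M) \<longleftrightarrow> d = Weak_Optional"
    and rest: "seq_intervals (b + subscript A) M
      = {(x, y) \<in> seq_intervals b ((d, A) # M). b + subscript A < y \<or> b + subscript A \<le> x}"
    if M: "linked ((d, A) # M)" for d M
  proof -
    have lM: "linked M" using M by (simp add: linked_Cons)
    have "(b, b) \<in> joint b d \<longleftrightarrow> d = Strong" by (cases d) auto
    then show "(b, b) \<in> seq_intervals b ((d, A) # M) \<longleftrightarrow> d = Strong"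
      using inner_bounds[of b b b A] seq_intervals_bounds[OF lM, of b b "b + subscript A"] k
      by (auto simp: seq_intervals_Cons)
    show "(b - 1, b + 1) \<in> seq_intervals b ((d, A) # M) \<longleftrightarrow> d = Weak_Optional" if "0 < b"
    proof -
      have "(b - 1, b + 1) \<in> joint b d \<longleftrightarrow> d = Weak_Optional" using that by (cases d) auto
      then show ?thesis
        using inner_bounds[of "b - 1" "b + 1" b A] that k
          seq_intervals_bounds[OF lM, of "b - 1" "b + 1" "b + subscript A"]
        by (auto simp: seq_intervals_Cons)
    qed
    have "y \<le> b + subscript A \<and> x < b + subscript A" if "(x, y) \<in> joint b d \<union> inner b A" for x y
      using that inner_bounds[of x y b A] k by (cases d) auto
    moreover have "b + subscript A < y \<or> b + subscript A \<le> x"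
      if "(x, y) \<in> seq_intervals (b + subscript A) M" for x y
      using seq_intervals_bounds[OF lM that] by auto
    ultimately show "seq_intervals (b + subscript A) M
      = {(x, y) \<in> seq_intervals b ((d, A) # M). b + subscript A < y \<or> b + subscript A \<le> x}"
      unfolding seq_intervals_Cons by fastforce
  qed
  have lin: "linked ((c, A) # K)" "linked ((c', A) # K')" using Cons.prems(1,2) by simp_all
  have "c = Strong \<longleftrightarrow> c' = Strong"
    using diag[OF lin(1)] diag[OF lin(2)] Z' by simp
  moreover have "c = Weak_Optional \<longleftrightarrow> c' = Weak_Optional"
    using opt[OF lin(1)] opt[OF lin(2)] Z' Cons.prems(4,5) by auto
  ultimately have c' [simp]: "c' = c" by (cases c; cases c') auto
  have "seq_intervals (b + subscript A) K = seq_intervals (b + subscript A) K'"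
    using rest[OF lin(1)] rest[OF lin(2)] Z' by simp
  then have "K = K'"
    using Cons.IH[of K' "b + subscript A"] lin k by (auto simp: linked_Cons)
  then show ?case by simp
qed

section \<open>Existence: the moves act on the last block\<close>

subsection \<open>Semiorders have no strictly nested intervals\<close>

text \<open>It suffices to compare endpoints: for intervals, \<open>a < b\<close> and \<open>c < d\<close> put \<open>[b, c]\<close> strictly inside
  \<open>[a, d]\<close>.\<close>

definition no_nesting :: "(nat \<times> nat) set \<Rightarrow> bool" where
  "no_nesting Z \<longleftrightarrow> (\<forall>a b c d. (a, d) \<in> Z \<longrightarrow> (b, c) \<in> Z \<longrightarrow> a < b \<longrightarrow> \<not> c < d)"

lemma no_nestingD: "no_nesting Z \<Longrightarrow> (a, d) \<in> Z \<Longrightarrow> (b, c) \<in> Z \<Longrightarrow> a < b \<Longrightarrow> c < d \<Longrightarrow> False"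
  by (auto simp: no_nesting_def)

text \<open>In a minimal endpoint representation the endpoints are positions in the chains of down sets and up
  sets, so no number up to the largest endpoint is skipped on either side.\<close>

definition spanning :: "nat \<Rightarrow> (nat \<times> nat) set \<Rightarrow> bool" where
  "spanning l Z \<longleftrightarrow> fst ` Z = {..l} \<and> snd ` Z = {..l} \<and> (\<forall>x y. (x, y) \<in> Z \<longrightarrow> x \<le> y)"

lemma spanning_bounds: "spanning l Z \<Longrightarrow> (x, y) \<in> Z \<Longrightarrow> x \<le> y \<and> y \<le> l"
  by (force simp: spanning_def)

text \<open>Choose intervals \<open>[x, a]\<close> and \<open>[d, z]\<close>. In a representation by intervals of equal length, the one
  for \<open>[b, c]\<close> fits strictly between those for \<open>[x, a]\<close> and \<open>[d, z]\<close>, but the one for \<open>[a, d]\<close> meets both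
  and would be longer.\<close>

lemma semiorder_no_nesting:
  assumes semi: "semiorder (rep_carrier M) (rep_order M)" and full: "spanning l (set_mset M)"
  shows "no_nesting (set_mset M)"
  unfolding no_nesting_def
proof (intro allI impI notI)
  fix a b c d
  assume ad: "(a, d) \<in># M" and bc: "(b, c) \<in># M" and "a < b" "c < d"
  have "a \<le> l" "d \<le> l" using spanning_bounds[OF full ad] by simp_all
  then have "a \<in> snd ` set_mset M" "d \<in> fst ` set_mset M"
    using full by (simp_all add: spanning_def)
  then obtain x z where x: "(x, a) \<in># M" and z: "(d, z) \<in># M" by force
  obtain lft rgt w where ia: "interval_assignment (rep_carrier M) (rep_order M) lft rgt"
    and len: "\<forall>p\<in>rep_carrier M. rgt p - lft p = w"
    using semi by (auto simp: semiorder_def)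
  have car: "(I, 0) \<in> rep_carrier M" if "I \<in># M" for I
    using that by (simp add: rep_carrier_def)
  have iff: "rgt (I, 0) < lft (J, 0) \<longleftrightarrow> snd I < fst J \<and> I \<noteq> J" if "I \<in># M" "J \<in># M" for I J
  proof -
    have "less_in (rep_order M) (I, 0) (J, 0) \<longleftrightarrow> rgt (I, 0) < lft (J, 0)"
      using ia car[OF that(1)] car[OF that(2)] unfolding interval_assignment_def by blast
    then show ?thesis
      using car[OF that(1)] car[OF that(2)] by (auto simp: less_in_def rep_order_def)
  qed
  have "b \<le> c" using spanning_bounds[OF full bc] by simp
  have "rgt ((x, a), 0) < lft ((b, c), 0)"
    using iff[OF x bc] \<open>a < b\<close> \<open>b \<le> c\<close> by auto
  moreover have "rgt ((b, c), 0) < lft ((d, z), 0)"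
    using iff[OF bc z] \<open>c < d\<close> \<open>b \<le> c\<close> by auto
  moreover have "lft ((a, d), 0) \<le> rgt ((x, a), 0)"
    using iff[OF x ad] by (simp add: not_less[symmetric])
  moreover have "lft ((d, z), 0) \<le> rgt ((a, d), 0)"
    using iff[OF ad z] by (simp add: not_less[symmetric])
  moreover have "rgt ((a, d), 0) - lft ((a, d), 0) = rgt ((b, c), 0) - lft ((b, c), 0)"
    using len car[OF ad] car[OF bc] by simp
  ultimately show False by linarith
qed

subsection \<open>The three moves on sets of intervals\<close>

definition shifted :: "nat \<Rightarrow> nat \<Rightarrow> (nat \<times> nat) set \<Rightarrow> (nat \<times> nat) set" where
  "shifted l i Z = insert (i, l + 1) (move3_interval l i ` Z)"

text \<open>The minimum \<open>\<ell>\<^sup>*\<close> is attained, so the third move comes with an interval that ends at \<open>l\<close> and starts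
  before \<open>i\<close>. The new interval of the first move is well-formed because \<open>\<ell>\<^sup>* \<le> l\<close>.\<close>

lemma psi_step_cases:
  assumes "spanning l (set_mset M)"
  obtains (add) "i \<le> l" "set_mset (psi_step M i) = insert (i, l) (set_mset M)"
  | (shift) x where "x < i" "i \<le> l" "(x, l) \<in># M"
      "set_mset (psi_step M i) = shifted l i (set_mset M)"
  | (new) "set_mset (psi_step M i) = insert (l + 1, l + 1) (set_mset M)"
proof -
  let ?F = "fst ` {I \<in> set_mset M. snd I = ell M}"
  have ell: "ell M = l"
  proof -
    have "Max {..l} = l" by (intro Max_eqI) auto
    then show ?thesis using assms by (simp add: ell_def spanning_def)
  qed
  have "l \<in> snd ` set_mset M" using assms by (simp add: spanning_def)
  then have ne: "?F \<noteq> {}" using ell by force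
  have fin: "finite ?F" by simp
  from Min_in[OF fin ne] obtain x where x: "x = ell_star M" "(x, l) \<in># M"
    unfolding ell_star_def using ell by force
  have "x \<le> l" using spanning_bounds[OF assms x(2)] by simp
  consider "i \<le> ell_star M" | "ell_star M < i" "i \<le> ell M" | "ell M < i" "ell_star M < i"
    using \<open>x \<le> l\<close> x(1) ell by linarith
  then show ?thesis
  proof cases
    case 1
    then show ?thesis using add x(1) \<open>x \<le> l\<close> ell by (simp add: psi_step_def)
  next
    case 2
    then show ?thesis using shift[of x] x ell by (simp add: psi_step_def shifted_def)
  next
    case 3
    then show ?thesis using new ell by (simp add: psi_step_def)
  qed
qed

lemma spanning_add:
  assumes "spanning l Z" "i \<le> l"
  shows "spanning l (insert (i, l) Z)"
  using assms by (auto simp: spanning_def)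

lemma spanning_new:
  assumes "spanning l Z"
  shows "spanning (l + 1) (insert (l + 1, l + 1) Z)"
  using assms by (auto simp: spanning_def)

text \<open>The third move opens a gap at \<open>i\<close> among the endpoints. As a left endpoint, \<open>i\<close> is supplied by the new
  interval; as a right endpoint, by the intervals \<open>[x, l]\<close> with \<open>x < i\<close>, which are cut back to \<open>[x, i]\<close>.\<close>

lemma spanning_shifted:
  assumes Z: "spanning l Z" and x: "x < i" "i \<le> l" "(x, l) \<in> Z"
  shows "spanning (l + 1) (shifted l i Z)"
proof -
  have bd: "a \<le> b \<and> b \<le> l" if "(a, b) \<in> Z" for a b using spanning_bounds[OF Z that] .
  have f: "move3_interval l i (a, b) \<in> shifted l i Z" if "(a, b) \<in> Z" for a b
    using that by (simp add: shifted_def)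
  have up: "a \<le> l + 1 \<and> b \<le> l + 1 \<and> a \<le> b" if "(a, b) \<in> shifted l i Z" for a b
  proof (cases "(a, b) = (i, l + 1)")
    case False
    then have "(a, b) \<in> move3_interval l i ` Z" using that by (auto simp: shifted_def)
    then obtain q where q: "(a, b) = move3_interval l i q" "q \<in> Z" by (rule imageE)
    obtain a' b' where q': "q = (a', b')" by (cases q)
    have "a' \<le> b' \<and> b' \<le> l" using bd q(2) q' by simp
    then show ?thesis
      using q(1) x(2) unfolding q' by (simp add: move3_interval_def split: if_splits)
  qed (use x(2) in simp)
  have lefts: "v \<in> fst ` shifted l i Z" if "v \<le> l + 1" for v
  proof -
    consider "v < i" | "v = i" | "i < v" by linarith
    then show ?thesis
    proof cases
      case 1
      then have "v \<in> fst ` Z" using Z x(2) by (simp add: spanning_def)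
      then obtain b where b: "(v, b) \<in> Z" by force
      have "fst (move3_interval l i (v, b)) = v"
        using bd[OF b] 1 by (simp add: move3_interval_def)
      then show ?thesis using imageI[OF f[OF b], of fst] by simp
    next
      case 2
      then show ?thesis by (simp add: shifted_def)
    next
      case 3
      then have "v - 1 \<in> fst ` Z" using Z that by (simp add: spanning_def)
      then obtain b where b: "(v - 1, b) \<in> Z" by force
      have "fst (move3_interval l i (v - 1, b)) = v"
        using bd[OF b] 3 by (auto simp: move3_interval_def)
      then show ?thesis using imageI[OF f[OF b], of fst] by simp
    qed
  qed
  have rights: "v \<in> snd ` shifted l i Z" if "v \<le> l + 1" for v
  proof -
    consider "v < i" | "v = i" | "i < v" "v \<le> l" | "v = l + 1" using \<open>v \<le> l + 1\<close> by linarith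
    then show ?thesis
    proof cases
      case 1
      then have "v \<in> snd ` Z" using Z x(2) by (simp add: spanning_def)
      then obtain a where a: "(a, v) \<in> Z" by force
      then have "(a, v) \<in> shifted l i Z"
        using f[OF a] bd[OF a] 1 x(2) by (auto simp: move3_interval_def)
      then show ?thesis by (rule rev_image_eqI) simp
    next
      case 2
      have "(x, i) \<in> shifted l i Z"
        using f[OF x(3)] x by (auto simp: move3_interval_def)
      then show ?thesis by (rule rev_image_eqI) (simp add: 2)
    next
      case 3
      then have "v - 1 \<in> snd ` Z" using Z by (simp add: spanning_def)
      then obtain a where a: "(a, v - 1) \<in> Z" by force
      have "snd (move3_interval l i (a, v - 1)) = v"
        using bd[OF a] 3 by (auto simp: move3_interval_def)
      then show ?thesis using imageI[OF f[OF a], of snd] by simp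
    next
      case 4
      then show ?thesis by (simp add: shifted_def)
    qed
  qed
  show ?thesis
    unfolding spanning_def
  proof (intro conjI allI impI)
    show "fst ` shifted l i Z = {..l + 1}"
    proof (intro equalityI subsetI)
      fix v assume "v \<in> fst ` shifted l i Z"
      then obtain b where "(v, b) \<in> shifted l i Z" by force
      then show "v \<in> {..l + 1}" using up by blast
    qed (use lefts in blast)
    show "snd ` shifted l i Z = {..l + 1}"
    proof (intro equalityI subsetI)
      fix v assume "v \<in> snd ` shifted l i Z"
      then obtain a where "(a, v) \<in> shifted l i Z" by force
      then show "v \<in> {..l + 1}" using up by blast
    qed (use rights in blast)
  qed (use up in blast)
qed

subsection \<open>Changing the last block\<close>

definition attachable :: "block_seq \<Rightarrow> boundary \<Rightarrow> block \<Rightarrow> bool" where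
  "attachable K c A \<longleftrightarrow> nontrivial_block A \<and>
     (if K = [] then c = Strong else boundary_allowed (snd (last K)) c A)"

lemma valid_seq_snoc:
  "valid_seq (K @ [(c, A)]) \<longleftrightarrow> valid_seq K \<and> attachable K c A"
proof (cases "K = []")
  case False
  have "successively compatible (K @ [(c, A)])
          \<longleftrightarrow> successively compatible K \<and> compatible (last K) (c, A)"
    using False by (simp add: successively_append_iff)
  then show ?thesis
    using False by (auto simp: valid_seq_def linked_def attachable_def compatible_def)
qed (auto simp: valid_seq_def linked_def attachable_def)

lemma seq_intervals_snoc:
  "seq_intervals 0 (K @ [(c, A)]) =
     placed 0 K \<union> joint (extent K) c \<union> inner (extent K) A
       \<union> {(extent K + subscript A, extent K + subscript A)}"
  by (auto simp: seq_intervals_def placed_append)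

lemma extent_pos: "valid_seq K \<Longrightarrow> K \<noteq> [] \<Longrightarrow> 0 < extent K"
  by (cases K) (auto simp: valid_seq_def linked_def subscript_pos)

text \<open>A weak boundary is never next to \<open>T\<^sub>1\<close> or between two \<open>W\<close>, and an optional element needs \<open>U\<close> or \<open>C\<close> on
  its left.\<close>

lemma before_W_type:
  assumes "valid_seq K" "attachable K c (Block_W k)" "c \<noteq> Strong"
  shows "K \<noteq> []" "is_C (snd (last K)) \<or> is_U (snd (last K))"
proof -
  show "K \<noteq> []" using assms(2,3) by (auto simp: attachable_def)
  then have "nontrivial_block (snd (last K))" "boundary_allowed (snd (last K)) c (Block_W k)"
    using assms(1,2) by (simp_all add: valid_seq_def linked_def attachable_def)
  then show "is_C (snd (last K)) \<or> is_U (snd (last K))"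
    using assms(3)
    by (cases c; cases "snd (last K)") (auto simp: is_C_def is_U_def is_W_def is_T1_def)
qed

text \<open>These two intervals of the preceding block produce the nestings that rule out unwanted moves on
  a final \<open>W\<^sub>1\<close>, for which the block itself contains no interval to be nested.\<close>

lemma before_W:
  assumes "valid_seq K" "attachable K c (Block_W k)" "c \<noteq> Strong"
  shows "2 \<le> extent K" "(extent K - 1, extent K) \<in> placed 0 K" "(extent K - 2, extent K) \<in> placed 0 K"
proof -
  obtain K' c' P where K: "K = K' @ [(c', P)]"
    using before_W_type(1)[OF assms] by (cases K rule: rev_cases) auto
  have "nontrivial_block P" using assms(1) K by (simp add: valid_seq_snoc attachable_def)
  moreover have "is_C P \<or> is_U P" using before_W_type(2)[OF assms] K by simp
  ultimately show "2 \<le> extent K" "(extent K - 1, extent K) \<in> placed 0 K"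
      "(extent K - 2, extent K) \<in> placed 0 K"
    using K by (auto simp: is_C_def is_U_def placed_append)
qed

lemma inner_W1: "inner b (Block_W 1) = {(b, b + 1)}"
  by auto

lemma inner_W2_to_C2: "insert (b, b + 2) (inner b (Block_W 2)) = inner b (Block_C 2)"
  by auto

lemma inner_W_to_C2:
  "insert (b + k, b + k + 2) (inner b (Block_W (k + 2)))
     = inner b (Block_W k) \<union> inner (b + k) (Block_C 2)"
  by auto

lemma inner_U_to_C:
  "1 \<le> k \<Longrightarrow> insert (b, b + k) (inner b (Block_U k)) = inner b (Block_C k)"
  by auto

text \<open>The first move. An interval \<open>[i, l]\<close> that reaches too far to the left encloses \<open>[b, b]\<close>, the first
  interval of length 1 of a \<open>U\<close> or \<open>C\<close>, the last but one interval of length 1 of a \<open>W\<close>, or, for a \<open>W\<^sub>1\<close>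
  behind a weak boundary, an interval of the preceding block. The few values of \<open>i\<close> that remain give
  an interval already present or the interval set of another block structure.\<close>

lemma add_interval:
  assumes L: "valid_seq L" and i: "i \<le> extent L"
    and nn: "no_nesting (insert (i, extent L) (seq_intervals 0 L))"
  shows "\<exists>L'. valid_seq L' \<and> seq_intervals 0 L' = insert (i, extent L) (seq_intervals 0 L)
           \<and> extent L' = extent L"
proof (cases L rule: rev_cases)
  case Nil
  then show ?thesis using i L by (intro exI[of _ L]) (simp add: seq_intervals_def)
next
  case (snoc K p)
  obtain c A where p: "p = (c, A)" by (cases p)
  define b where "b = extent K"
  have K: "valid_seq K" and att: "attachable K c A" and nt: "nontrivial_block A"
    using L snoc p by (auto simp: valid_seq_snoc attachable_def)
  let ?Z = "seq_intervals 0 L"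
  have l: "extent L = b + subscript A" using snoc p by (simp add: b_def)
  have Z: "?Z = placed 0 K \<union> joint b c \<union> inner b A \<union> {(b + subscript A, b + subscript A)}"
    using seq_intervals_snoc[of K c A] snoc p by (simp add: b_def)
  have nest: False if "(x, y) \<in> ?Z" "i < x" "y < extent L" for x y
    using no_nestingD[OF nn, of i "extent L" x y] that by simp
  have same: ?thesis if "(i, extent L) \<in> ?Z"
    using that L by (intro exI[of _ L]) auto
  have replace: ?thesis if "attachable K c' A'" "subscript A' = subscript A"
      "insert (i, extent L) (joint b c \<union> inner b A) = joint b c' \<union> inner b A'" for c' A'
  proof -
    have "seq_intervals 0 (K @ [(c', A')])
            = placed 0 K \<union> (joint b c' \<union> inner b A') \<union> {(extent L, extent L)}"
      using that(2) l by (simp add: seq_intervals_snoc b_def Un_assoc)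
    also have "\<dots> = insert (i, extent L) ?Z"
      unfolding that(3)[symmetric] Z l by blast
    finally show ?thesis
      using that(1,2) K l by (intro exI[of _ "K @ [(c', A')]"]) (simp add: valid_seq_snoc b_def)
  qed
  show ?thesis
  proof (cases A)
    case Block_T1
    then have c: "c = Strong"
      using att by (cases c) (auto simp: attachable_def is_T1_def is_W_def split: if_splits)
    consider "i = b + 1" | "i = b" | "i < b"
      using i l Block_T1 by (simp, linarith)
    then show ?thesis
    proof cases
      case 1
      then show ?thesis using same Z l Block_T1 by simp
    next
      case 2
      have "attachable K Strong (Block_W 1)" by (simp add: attachable_def)
      moreover have "insert (i, extent L) (joint b c \<union> inner b A)
                       = joint b Strong \<union> inner b (Block_W 1)"
        unfolding inner_W1 using 2 l Block_T1 c by auto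
      ultimately show ?thesis using Block_T1 by (intro replace[of Strong "Block_W 1"]) simp_all
    next
      case 3
      then show ?thesis using nest[of b b] Z l Block_T1 c by simp
    qed
  next
    case (Block_W k)
    then have k: "1 \<le> k" "subscript A = k" using nt by simp_all
    consider "i = b + k \<or> i + 1 = b + k" | "i + 2 = b + k" | "i + 3 \<le> b + k"
      using i l k by linarith
    then show ?thesis
    proof cases
      case 1
      then have "(i, extent L) \<in> ?Z"
      proof
        assume "i = b + k"
        then show ?thesis using Z l k by simp
      next
        assume "i + 1 = b + k"
        then have "(i, extent L) \<in> inner b A" using l k Block_W by simp
        then show ?thesis using Z by simp
      qed
      then show ?thesis by (rule same)
    next
      case 2
      consider "k = 1" | "k = 2" | "3 \<le> k" using k by linarith
      then show ?thesis
      proof cases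
        case 1
        show ?thesis
        proof (cases c)
          case Strong
          then show ?thesis using nest[of b b] Z l k 1 2 by simp
        next
          case Weak
          have weak: "attachable K Weak (Block_W k)" using att Weak Block_W by simp
          have "attachable K Weak_Optional (Block_W 1)"
            using before_W_type[OF K weak] by (simp add: attachable_def is_W_def)
          moreover have "i = b - 1" using 1 2 by simp
          then have "insert (i, extent L) (joint b c \<union> inner b A)
                       = joint b Weak_Optional \<union> inner b (Block_W 1)"
            using 1 l k Weak Block_W by simp
          ultimately show ?thesis using k 1 by (intro replace[of Weak_Optional "Block_W 1"]) simp_all
        next
          case Weak_Optional
          have "i = b - 1" using 1 2 by simp
          then show ?thesis using same Z l k 1 2 Weak_Optional by simp
        qed
      next
        case k2: 2
        have "attachable K c (Block_C 2)"
          using att Block_W by (cases c) (auto simp: attachable_def is_W_def is_T1_def)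
        moreover have "i = b" using 2 k2 by simp
        then have "insert (i, extent L) (joint b c \<union> inner b A) = joint b c \<union> inner b (Block_C 2)"
          unfolding inner_W2_to_C2[symmetric] using l k k2 Block_W by simp
        ultimately show ?thesis using k k2 by (intro replace[of c "Block_C 2"]) simp_all
      next
        case 3
        define m where "m = k - 2"
        have m: "k = m + 2" "1 \<le> m" using 3 by (simp_all add: m_def)
        let ?L = "K @ [(c, Block_W m)]"
        have "attachable K c (Block_W m)"
          using att Block_W m by (cases c) (auto simp: attachable_def is_W_def is_T1_def)
        moreover have "attachable ?L Weak (Block_C 2)"
          by (simp add: attachable_def is_W_def is_T1_def)
        ultimately have "valid_seq (?L @ [(Weak, Block_C 2)])"
          using K valid_seq_snoc by blast
        moreover have "extent (?L @ [(Weak, Block_C 2)]) = extent L"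
          using l k m by (simp add: b_def)
        moreover have "seq_intervals 0 (?L @ [(Weak, Block_C 2)]) = insert (i, extent L) ?Z"
        proof -
          have "i = b + m" "extent L = b + m + 2" using 2 l k m by simp_all
          have "seq_intervals 0 (?L @ [(Weak, Block_C 2)]) = placed 0 K \<union> joint b c
              \<union> (inner b (Block_W m) \<union> inner (b + m) (Block_C 2)) \<union> {(b + m + 2, b + m + 2)}"
            unfolding seq_intervals_snoc placed_append
            by (simp add: b_def Un_assoc del: inner.simps)
          also have "\<dots> = insert (i, extent L) ?Z"
            unfolding inner_W_to_C2[symmetric] Z
            using Block_W m \<open>i = b + m\<close> \<open>extent L = b + m + 2\<close>
            by (simp add: insert_commute del: inner.simps)
          finally show ?thesis .
        qed
        ultimately show ?thesis by blast
      qed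
    next
      case 3
      show ?thesis
      proof (cases "2 \<le> k")
        case True
        then have "(b + k - 2, b + k - 1) \<in> inner b A" using Block_W by auto
        then have "(b + k - 2, b + k - 1) \<in> ?Z" using Z by simp
        moreover have "i < b + k - 2" "b + k - 1 < extent L" using 3 l k True by simp_all
        ultimately show ?thesis using nest by blast
      next
        case False
        then have "k = 1" using k by simp
        show ?thesis
        proof (cases "c = Strong")
          case True
          then show ?thesis using nest[of b b] 3 Z l k \<open>k = 1\<close> by simp
        next
          case False
          then have "(b - 1, b) \<in> ?Z"
            using before_W(2)[OF K, of c k] att Block_W Z by (simp add: b_def)
          moreover have "i < b - 1" "b < extent L" using 3 l k \<open>k = 1\<close> by simp_all
          ultimately show ?thesis using nest by blast
        qed
      qed
    qed
  next
    case (Block_U k)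
    consider "b < i" | "i = b" | "i < b" by linarith
    then show ?thesis
    proof cases
      case 1
      have "(i, extent L) \<in> ?Z"
      proof (cases "i = b + k")
        case True
        then show ?thesis using Z l Block_U by simp
      next
        case False
        then have "(i, extent L) \<in> inner b A" using \<open>b < i\<close> i l Block_U by auto
        then show ?thesis using Z by simp
      qed
      then show ?thesis by (rule same)
    next
      case 2
      have "attachable K c (Block_C k)"
        using att Block_U
        by (cases c) (auto simp: attachable_def is_W_def is_T1_def split: if_splits)
      moreover have "insert (i, extent L) (joint b c \<union> inner b A) = joint b c \<union> inner b (Block_C k)"
        using inner_U_to_C[of k b] 2 l Block_U nt by (simp del: inner.simps) blast
      ultimately show ?thesis using Block_U by (intro replace[of c "Block_C k"]) simp_all
    next
      case 3
      then show ?thesis using nest[of b "b + 1"] Z l Block_U nt by simp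
    qed
  next
    case (Block_C k)
    show ?thesis
    proof (cases "b \<le> i")
      case True
      have "(i, extent L) \<in> ?Z"
      proof (cases "i = b + k")
        case True
        then show ?thesis using Z l Block_C by simp
      next
        case False
        then have "(i, extent L) \<in> inner b A" using \<open>b \<le> i\<close> i l Block_C by auto
        then show ?thesis using Z by simp
      qed
      then show ?thesis by (rule same)
    next
      case False
      then show ?thesis using nest[of b "b + 1"] Z l Block_C nt by simp
    qed
  qed (use nt in simp)
qed

text \<open>The third move at \<open>i = l\<close> moves only the degenerate interval at the end.\<close>

lemma shift_at_end:
  assumes "valid_seq L"
  shows "shifted (extent L) (extent L) (seq_intervals 0 L)
           = placed 0 L \<union> {(extent L, extent L + 1), (extent L + 1, extent L + 1)}"
proof -
  have "move3_interval (extent L) (extent L) (x, y) = (x, y)" if "(x, y) \<in> placed 0 L" for x y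
    using placed_bounds[OF _ that] assms
    by (auto simp: move3_interval_def valid_seq_def linked_def)
  then have "move3_interval (extent L) (extent L) ` placed 0 L = placed 0 L"
    by (force simp: image_iff)
  then show ?thesis
    by (auto simp: shifted_def seq_intervals_def move3_interval_def)
qed

text \<open>The long interval \<open>[b, b + k]\<close> is cut back to \<open>[b, b + 1]\<close> and thereby refills the place left by the
  other intervals starting at \<open>b\<close>, which all grow by 1.\<close>

lemma shift_C_to_U:
  assumes "2 \<le> k"
  shows "shifted (b + k) (b + 1) (inner b (Block_C k)) = inner b (Block_U (k + 1))"
proof (intro equalityI subrelI)
  fix x y assume "(x, y) \<in> shifted (b + k) (b + 1) (inner b (Block_C k))"
  then show "(x, y) \<in> inner b (Block_U (k + 1))"
    using assms by (auto simp: shifted_def move3_interval_def split: if_splits)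
next
  fix x y assume xy: "(x, y) \<in> inner b (Block_U (k + 1))"
  have f: "move3_interval (b + k) (b + 1) (x', y') \<in> shifted (b + k) (b + 1) (inner b (Block_C k))"
    if "(x', y') \<in> inner b (Block_C k)" for x' y'
    using that by (simp add: shifted_def)
  consider "x = b" "y = b + 1" | "x = b" "b + 1 < y" "y \<le> b + k"
    | "x = b + 1" "y = b + k + 1" | "b + 1 < x" "x < y" "y = b + k + 1"
    using xy by fastforce
  then show "(x, y) \<in> shifted (b + k) (b + 1) (inner b (Block_C k))"
  proof cases
    case 1
    then show ?thesis using f[of b "b + k"] assms by (auto simp: move3_interval_def)
  next
    case 2
    then have "(b, y - 1) \<in> inner b (Block_C k)"
      and "move3_interval (b + k) (b + 1) (b, y - 1) = (x, y)"
      by (auto simp: move3_interval_def)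
    then show ?thesis using f[of b "y - 1"] by simp
  next
    case 3
    then show ?thesis by (simp add: shifted_def)
  next
    case 4
    then have "(x - 1, b + k) \<in> inner b (Block_C k)"
      and "move3_interval (b + k) (b + 1) (x - 1, b + k) = (x, y)"
      by (auto simp: move3_interval_def)
    then show ?thesis using f[of "x - 1" "b + k"] by simp
  qed
qed

text \<open>The third move. For \<open>i = l\<close> it extends a \<open>W\<close> or starts a new one, and for \<open>i = b + 1\<close> it turns \<open>C\<close> into
  \<open>U\<close>. Otherwise, in \<open>U\<close> and \<open>C\<close>, the interval \<open>[b + 1, l]\<close> is cut back to \<open>[b + 1, i]\<close> while \<open>[b, l - 1]\<close>
  grows to \<open>[b, l]\<close> and encloses it. Optional elements at the last boundary lead to similar nestings.\<close>

lemma shift_intervals: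
  assumes L: "valid_seq L" and x: "x < i" "i \<le> extent L" "(x, extent L) \<in> seq_intervals 0 L"
    and nn: "no_nesting (shifted (extent L) i (seq_intervals 0 L))"
  shows "\<exists>L'. valid_seq L' \<and> seq_intervals 0 L' = shifted (extent L) i (seq_intervals 0 L)
           \<and> extent L' = extent L + 1"
proof (cases L rule: rev_cases)
  case Nil
  then show ?thesis using x by simp
next
  case (snoc K p)
  obtain c A where p: "p = (c, A)" by (cases p)
  define b where "b = extent K"
  have K: "valid_seq K" and att: "attachable K c A" and nt: "nontrivial_block A"
    using L snoc p by (auto simp: valid_seq_snoc attachable_def)
  let ?Z = "seq_intervals 0 L"
  let ?f = "move3_interval (extent L) i"
  have l: "extent L = b + subscript A" using snoc p by (simp add: b_def)
  have placed: "placed 0 L = placed 0 K \<union> joint b c \<union> inner b A"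
    using snoc p by (simp add: placed_append b_def Un_assoc)
  have Z: "?Z = placed 0 K \<union> joint b c \<union> inner b A \<union> {(b + subscript A, b + subscript A)}"
    using seq_intervals_snoc[of K c A] snoc p by (simp add: b_def)
  have pK: "x' < b \<and> y' \<le> b" if "(x', y') \<in> placed 0 K" for x' y'
    using placed_bounds[OF _ that] K by (auto simp: valid_seq_def linked_def b_def)
  have xl: "(x, extent L) \<in> joint b c \<or> (x, extent L) \<in> inner b A"
    using x Z pK subscript_pos[OF nt] l by fastforce
  have nest: False if "(u, v) \<in> ?Z" "(u', v') \<in> ?Z" "fst (?f (u, v)) < fst (?f (u', v'))"
      "snd (?f (u', v')) < snd (?f (u, v))" for u v u' v'
    using no_nestingD[OF nn, of "fst (?f (u, v))" "snd (?f (u, v))"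
        "fst (?f (u', v'))" "snd (?f (u', v'))"] that
    by (simp add: shifted_def)
  have middle: False if "(b + 1, extent L) \<in> ?Z" "(b, extent L - 1) \<in> ?Z" "b + 2 \<le> i" "i < extent L"
  proof -
    have "?f (b + 1, extent L) = (b + 1, i)" "?f (b, extent L - 1) = (b, extent L)"
      using that(3,4) by (auto simp: move3_interval_def)
    then show False using nest[OF that(2,1)] that(4) by simp
  qed
  show ?thesis
  proof (cases A)
    case Block_T1
    then have "c = Strong"
      using att by (cases c) (auto simp: attachable_def is_T1_def is_W_def split: if_splits)
    then show ?thesis using xl Block_T1 l by simp
  next
    case (Block_W k)
    then have k: "1 \<le> k" "subscript A = k" using nt by simp_all
    show ?thesis
    proof (cases "i = extent L")
      case True
      have "attachable K c (Block_W (k + 1))"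
        using att Block_W by (cases c) (auto simp: attachable_def is_W_def is_T1_def)
      moreover have "seq_intervals 0 (K @ [(c, Block_W (k + 1))]) = shifted (extent L) i ?Z"
        unfolding True shift_at_end[OF L] placed seq_intervals_snoc
        using l Block_W by (auto simp: b_def)
      ultimately show ?thesis
        using K l k by (intro exI[of _ "K @ [(c, Block_W (k + 1))]"]) (simp add: valid_seq_snoc b_def)
    next
      case False
      have "(x, extent L) \<in> joint b c" using xl False x l Block_W by auto
      then have wo: "c = Weak_Optional" "k = 1" "x = b - 1"
        using l k x by (cases c; auto)+
      have b: "2 \<le> b" "(b - 1, b) \<in> placed 0 K" "(b - 2, b) \<in> placed 0 K"
        using before_W[OF K, of c k] att Block_W wo by (simp_all add: b_def)
      \<comment> \<open>The optional interval \<open>[b - 1, b + 1]\<close> is cut back to \<open>[b - 1, b]\<close> and ends up strictly inside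
        the enlarged \<open>[b - 2, b + 1]\<close>.\<close>
      have "i = b" using wo b x l k False by linarith
      then have "?f (b - 2, b) = (b - 2, b + 1)" "?f (b - 1, b + 1) = (b - 1, b)"
        using b(1) wo l k by (auto simp: move3_interval_def)
      moreover have "b - 2 < b - 1" using b(1) by simp
      moreover have "(b - 1, b + 1) \<in> ?Z" "(b - 2, b) \<in> ?Z" using b Z wo by auto
      ultimately show ?thesis
        using nest[of "b - 2" b "b - 1" "b + 1"] by simp
    qed
  next
    case (Block_U k)
    then have k: "3 \<le> k" using nt by simp
    show ?thesis
    proof (cases "i = extent L")
      case True
      have "attachable L Weak (Block_W 1)"
        using snoc p Block_U by (simp add: attachable_def is_W_def is_T1_def)
      then show ?thesis
        unfolding True shift_at_end[OF L] using L
        by (intro exI[of _ "L @ [(Weak, Block_W 1)]"])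
           (auto simp: valid_seq_snoc seq_intervals_snoc)
    next
      case False
      have "b + 1 \<le> x" using xl l k Block_U by (cases c) auto
      then have "b + 2 \<le> i" "i < extent L" using x False by simp_all
      moreover have "(b + 1, extent L) \<in> ?Z" "(b, extent L - 1) \<in> ?Z"
        using Z l k Block_U by auto
      ultimately show ?thesis using middle by blast
    qed
  next
    case (Block_C k)
    then have k: "2 \<le> k" using nt by simp
    consider "i = extent L" | "b + 2 \<le> i" "i < extent L" | "i = b + 1" "i < extent L" | "i \<le> b"
      using x by linarith
    then show ?thesis
    proof cases
      case 1
      have "attachable L Weak (Block_W 1)"
        using snoc p Block_C by (simp add: attachable_def is_W_def is_T1_def)
      then show ?thesis
        unfolding 1 shift_at_end[OF L] using L
        by (intro exI[of _ "L @ [(Weak, Block_W 1)]"])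
           (auto simp: valid_seq_snoc seq_intervals_snoc)
    next
      case 2
      moreover have "(b + 1, extent L) \<in> ?Z" "(b, extent L - 1) \<in> ?Z"
        using Z l k Block_C by auto
      ultimately show ?thesis using middle by blast
    next
      case 3
      show ?thesis
      proof (cases "c = Weak_Optional")
        case True
        have "K \<noteq> []" using att True by (auto simp: attachable_def)
        then have "0 < b" using extent_pos[OF K] by (simp add: b_def)
        have "k = 2" using att Block_C True \<open>K \<noteq> []\<close> by (simp add: attachable_def is_W_def)
        \<comment> \<open>\<open>C\<^sub>2\<close> behind an optional element would become \<open>U\<^sub>3\<close>, which admits none: the optional
          interval grows while \<open>[b, b + 2]\<close> is cut back into it.\<close>
        have "?f (b - 1, b + 1) = (b - 1, b + 2)" "?f (b, b + 2) = (b, b + 1)"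
          using 3 l Block_C \<open>k = 2\<close> \<open>0 < b\<close> by (auto simp: move3_interval_def)
        moreover have "(b - 1, b + 1) \<in> ?Z" "(b, b + 2) \<in> ?Z"
          using Z Block_C True \<open>k = 2\<close> by auto
        moreover have "b - 1 < b" using \<open>0 < b\<close> by simp
        ultimately show ?thesis
          using nest[of "b - 1" "b + 1" b "b + 2"] by simp
      next
        case False
        have "attachable K c (Block_U (k + 1))"
          using att Block_C False by (cases c) (auto simp: attachable_def is_W_def is_T1_def)
        moreover have "shifted (extent L) i ?Z = seq_intervals 0 (K @ [(c, Block_U (k + 1))])"
        proof -
          have "?f q = q" if "q \<in> placed 0 K \<union> joint b c" for q
            using that False 3 pK by (cases q; cases c) (fastforce simp: move3_interval_def)+
          then have "?f ` (placed 0 K \<union> joint b c) = placed 0 K \<union> joint b c"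
            by force
          moreover have "?f (b + k, b + k) = (b + k + 1, b + k + 1)"
            using 3 l Block_C by (simp add: move3_interval_def)
          ultimately have "shifted (extent L) i ?Z = placed 0 K \<union> joint b c
              \<union> shifted (extent L) i (inner b A) \<union> {(b + k + 1, b + k + 1)}"
            unfolding Z shifted_def using Block_C by (auto simp: image_Un)
          then show ?thesis
            using shift_C_to_U[OF k, of b] 3 l Block_C
            by (simp add: seq_intervals_snoc b_def)
        qed
        ultimately show ?thesis
          using K l Block_C
          by (intro exI[of _ "K @ [(c, Block_U (k + 1))]"]) (simp add: valid_seq_snoc b_def)
      qed
    next
      case 4
      then show ?thesis using xl x l k Block_C by (cases c) auto
    qed
  qed (use nt in simp)
qed

lemma psi_step_valid_seq:
  assumes L: "valid_seq L" "set_mset M = seq_intervals 0 L" and full: "spanning (extent L) (set_mset M)"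
    and semi: "semiorder (rep_carrier (psi_step M i)) (rep_order (psi_step M i))"
  shows "\<exists>L'. valid_seq L' \<and> set_mset (psi_step M i) = seq_intervals 0 L'
           \<and> spanning (extent L') (set_mset (psi_step M i))"
  using full
proof (cases rule: psi_step_cases[of _ _ i])
  case add
  have s: "spanning (extent L) (set_mset (psi_step M i))"
    unfolding add(2) by (rule spanning_add[OF full add(1)])
  show ?thesis
    using add_interval[OF L(1) add(1)] semiorder_no_nesting[OF semi s] s add(2) L(2) by metis
next
  case (shift x)
  have s: "spanning (extent L + 1) (set_mset (psi_step M i))"
    unfolding shift(4) by (rule spanning_shifted[OF full shift(1-3)])
  show ?thesis
    using shift_intervals[OF L(1) shift(1,2)] semiorder_no_nesting[OF semi s] s shift(3,4) L(2)
    by metis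
next
  case new
  have "valid_seq (L @ [(Strong, Block_T1)])"
    using L(1) by (simp add: valid_seq_snoc attachable_def)
  moreover have "seq_intervals 0 (L @ [(Strong, Block_T1)]) = set_mset (psi_step M i)"
    unfolding new L(2) by (auto simp: seq_intervals_snoc) (auto simp: seq_intervals_def)
  moreover have "spanning (extent (L @ [(Strong, Block_T1)])) (set_mset (psi_step M i))"
    using spanning_new[OF full] new by simp
  ultimately show ?thesis by metis
qed

lemma psi_inv_valid_seq:
  assumes "xs \<noteq> []"
    and "\<forall>i. 1 \<le> i \<and> i \<le> length xs \<longrightarrow>
          semiorder (rep_carrier (psi_inv (take i xs))) (rep_order (psi_inv (take i xs)))"
  shows "\<exists>L. valid_seq L \<and> set_mset (psi_inv xs) = seq_intervals 0 L
           \<and> spanning (extent L) (set_mset (psi_inv xs))"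
  using assms
proof (induction xs rule: rev_nonempty_induct)
  case (single x)
  show ?case
    by (intro exI[of _ "[]"])
       (simp add: psi_inv_def seq_intervals_def valid_seq_def linked_def spanning_def)
next
  case (snoc x xs)
  have "semiorder (rep_carrier (psi_inv (take i xs))) (rep_order (psi_inv (take i xs)))"
    if "1 \<le> i" "i \<le> length xs" for i
    using snoc.prems[rule_format, of i] that by simp
  then obtain L where L: "valid_seq L" "set_mset (psi_inv xs) = seq_intervals 0 L"
      "spanning (extent L) (set_mset (psi_inv xs))"
    using snoc.IH by blast
  have step: "psi_inv (xs @ [x]) = psi_step (psi_inv xs) x"
    using snoc.hyps by (simp add: psi_inv_def)
  have "semiorder (rep_carrier (psi_inv (xs @ [x]))) (rep_order (psi_inv (xs @ [x])))"
    using snoc.prems[rule_format, of "length (xs @ [x])"] by simp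
  then show ?case
    using psi_step_valid_seq[OF L] unfolding step by blast
qed

section \<open>Block structures of hereditary semiorders\<close>

theorem theorem2p5:
  fixes X :: "'a set" and r :: "('a \<times> 'a) set"
  assumes "hereditary_semiorder X r"
  shows "\<exists>!S :: block_structure.
           is_block_structure S \<and> set_mset (min_endpoint_rep X r) = interval_set S"
proof -
  obtain xs where "ascent_sequence xs" and rep: "min_endpoint_rep X r = psi_inv xs"
    and semi: "\<forall>i. 1 \<le> i \<and> i \<le> length xs \<longrightarrow>
          semiorder (rep_carrier (psi_inv (take i xs))) (rep_order (psi_inv (take i xs)))"
    using assms by (auto simp: hereditary_semiorder_def Psi_def)
  then have "xs \<noteq> []" by (simp add: ascent_sequence_def)
  from psi_inv_valid_seq[OF this semi] obtain L
    where L: "valid_seq L" "set_mset (min_endpoint_rep X r) = seq_intervals 0 L"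
    unfolding rep by blast
  show ?thesis
  proof (intro ex1I[of _ "structure_of L"] conjI)
    show "is_block_structure (structure_of L)"
      using L(1) is_block_structure_iff by blast
    show "set_mset (min_endpoint_rep X r) = interval_set (structure_of L)"
      using L interval_set_structure_of by simp
  next
    fix S assume S: "is_block_structure S \<and> set_mset (min_endpoint_rep X r) = interval_set S"
    then obtain L' where L': "valid_seq L'" "S = structure_of L'"
      using is_block_structure_iff by blast
    have "seq_intervals 0 L' = seq_intervals 0 L"
      using S L L' interval_set_structure_of by simp
    then have "L' = L"
      using seq_intervals_inject[of L' L 0] L(1) L'(1) by (simp add: valid_seq_def)
    then show "S = structure_of L" using L'(2) by simp
  qed
qed

end
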